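(* Let $F$ be a piecewise interval map (PIM) on $[0,1)$. If $F$ satisfies topological transitivity (TT), then $F$ satisfies Parry topological transitivity (PTT).
   Context: Let $\lambda$ be Lebesgue measure on $[0,1)$. An interval partition is a finite or countable indexed collection $\xi=\{\Delta(d)\subseteq[0,1):d\in\mathcal D\}$ of disjoint intervals, $2\le \#(\xi)\le\infty$, with $\lambda(D)=1$ where $D=\bigcup_{d\in\mathcal D}\Delta(d)$. Each $\Delta(d)$ has endpoints $a_d<b_d$ and may be open, closed, or half-open on either side. A piecewise interval map (PIM) $F$ on $[0,1)$ is an interval partition $\xi$ together with a map $F:D\to[0,1)$ such that: (1) each $F|_{\Delta(d)}$ is continuous and strictly monotonic; (2) $\lambda([0,1)\setminus B)=0$, where $B=\{x: F^n x\in D \text{ for all } n\ge 0\}$; (3) for all $n\ge1$ and $d_1,\dots,d_n\in\mathcal D$, the set $\Delta(d_1d_2\dots d_n)=\Delta(d_1)\cap F^{-1}\Delta(d_2)\cap\dots\cap F^{-n+1}\Delta(d_n)$ is either empty or an interval of positive length. $F$ is not required to be surjective. TT: there is $x\in B$ such that the forward orbit $O^+(x)=\{F^n x:n\ge 0\}$ is dense in $[0,1)$. PTT: there is $x\in[0,1)$ such that the backward orbit $O^-(x)=\{y: F^n y \text{ is defined and } x=F^n y\text{ for some } n\ge 0\}$ is dense in $[0,1)$. *)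

theory Defs
  imports "HOL-Analysis.Analysis"
begin

definition nondegenerate_interval :: "real set \<Rightarrow> bool" where
  "nondegenerate_interval S \<longleftrightarrow>
     (\<exists>a b. a < b \<and> (S = {a<..<b} \<or> S = {a..b} \<or> S = {a..<b} \<or> S = {a<..b}))"

definition interval_partition :: "'d set \<Rightarrow> ('d \<Rightarrow> real set) \<Rightarrow> bool" where
  "interval_partition I \<Delta> \<longleftrightarrow>
     countable I \<and> (infinite I \<or> 2 \<le> card I) \<and>
     (\<forall>d\<in>I. nondegenerate_interval (\<Delta> d) \<and> \<Delta> d \<subseteq> {0..<1}) \<and>
     disjoint_family_on \<Delta> I \<and>
     emeasure lebesgue (\<Union>d\<in>I. \<Delta> d) = 1"

text \<open>
  A partial map from \<open>D \<subseteq> {0..<1}\<close> to \<open>{0..<1}\<close> is represented by a total function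
  \<open>F :: real \<Rightarrow> real\<close> together with \<open>D\<close>; the values of \<open>F\<close> outside \<open>D\<close> are junk. The
  \<open>n\<close>-th iterate is therefore defined at a point only if the first \<open>n\<close> points of its orbit,
  those with index below \<open>n\<close>, lie in \<open>D\<close>.
\<close>

definition iter_dom :: "real set \<Rightarrow> (real \<Rightarrow> real) \<Rightarrow> nat \<Rightarrow> real set" where
  "iter_dom D F n = {x \<in> {0..<1}. \<forall>k<n. (F ^^ k) x \<in> D}"

definition iter_preimage :: "real set \<Rightarrow> (real \<Rightarrow> real) \<Rightarrow> nat \<Rightarrow> real set \<Rightarrow> real set" where
  "iter_preimage D F n A = {x \<in> iter_dom D F n. (F ^^ n) x \<in> A}"

definition nonescaping :: "real set \<Rightarrow> (real \<Rightarrow> real) \<Rightarrow> real set" where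
  "nonescaping D F = {x. \<forall>n. x \<in> iter_dom D F n \<and> (F ^^ n) x \<in> D}"

definition cylinder :: "'d set \<Rightarrow> ('d \<Rightarrow> real set) \<Rightarrow> (real \<Rightarrow> real) \<Rightarrow> 'd list \<Rightarrow> real set" where
  "cylinder I \<Delta> F ds = (\<Inter>i<length ds. iter_preimage (\<Union>d\<in>I. \<Delta> d) F i (\<Delta> (ds ! i)))"

definition PIM :: "'d set \<Rightarrow> ('d \<Rightarrow> real set) \<Rightarrow> (real \<Rightarrow> real) \<Rightarrow> bool" where
  "PIM I \<Delta> F \<longleftrightarrow>
     interval_partition I \<Delta> \<and>
     F ` (\<Union>d\<in>I. \<Delta> d) \<subseteq> {0..<1} \<and>
     (\<forall>d\<in>I. continuous_on (\<Delta> d) F \<and>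
        (strict_mono_on (\<Delta> d) F \<or> strict_antimono_on (\<Delta> d) F)) \<and>
     {0..<1} - nonescaping (\<Union>d\<in>I. \<Delta> d) F \<in> null_sets lebesgue \<and>
     (\<forall>ds. ds \<noteq> [] \<and> set ds \<subseteq> I \<longrightarrow>
        cylinder I \<Delta> F ds = {} \<or> nondegenerate_interval (cylinder I \<Delta> F ds))"

definition dense_in_unit :: "real set \<Rightarrow> bool" where
  "dense_in_unit S \<longleftrightarrow> S \<subseteq> {0..<1} \<and> {0..<1} \<subseteq> closure S"

definition forward_orbit :: "(real \<Rightarrow> real) \<Rightarrow> real \<Rightarrow> real set" where
  "forward_orbit F x = {(F ^^ n) x | n. True}"

definition backward_orbit :: "real set \<Rightarrow> (real \<Rightarrow> real) \<Rightarrow> real \<Rightarrow> real set" where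
  "backward_orbit D F x = {y. \<exists>n. y \<in> iter_dom D F n \<and> x = (F ^^ n) y}"

definition TT :: "'d set \<Rightarrow> ('d \<Rightarrow> real set) \<Rightarrow> (real \<Rightarrow> real) \<Rightarrow> bool" where
  "TT I \<Delta> F \<longleftrightarrow>
     (\<exists>x\<in>nonescaping (\<Union>d\<in>I. \<Delta> d) F. dense_in_unit (forward_orbit F x))"

definition PTT :: "'d set \<Rightarrow> ('d \<Rightarrow> real set) \<Rightarrow> (real \<Rightarrow> real) \<Rightarrow> bool" where
  "PTT I \<Delta> F \<longleftrightarrow>
     (\<exists>x\<in>{0..<1}. dense_in_unit (backward_orbit (\<Union>d\<in>I. \<Delta> d) F x))"

end

(* For an open U meeting [0,1), let G(U) be the union over n of the interiors of F^n(U).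
   If the orbit of x is dense and F^m x lies in U, then a ball in U around F^m x meets the cylinder of
   length n through F^m x in a nondegenerate interval on which F^n is continuous and injective,
   so its image is a nondegenerate interval containing F^(m+n) x. Hence the closure of G(U)
   contains a tail of a dense orbit, and G(U) is a dense open set. By Baire's theorem some z
   lies in G(U) for all U in a countable basis, and the backward orbit of z meets every such U. *)
theory Submission
  imports Defs
begin

section \<open>Intervals and connected subsets of the line\<close>

lemma connected_subset_closure_interior:
  fixes C :: "real set"
  assumes "connected C" "a \<in> C" "b \<in> C" "a \<noteq> b"
  shows "C \<subseteq> closure (interior C)"
proof -
  obtain u v where uv: "u \<in> C" "v \<in> C" "u < v"
    using assms by (metis linorder_neqE_linordered_idom)
  have "{u..v} \<subseteq> C"
    using assms(1) uv connected_contains_Icc by blast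
  then have "interior C \<noteq> {}"
    using interior_mono[of "{u..v}" C] uv(3) by (auto simp: interior_atLeastAtMost_real)
  \<comment> \<open>A convex set with nonempty interior has the same closure as its
    interior.\<close>
  moreover have "convex C"
    using assms(1) by (simp add: connected_convex_1)
  ultimately show ?thesis
    using convex_closure_interior closure_subset by blast
qed

lemma nondegenerate_interval_convex: "nondegenerate_interval S \<Longrightarrow> convex S"
  by (auto simp: nondegenerate_interval_def)

text \<open>A connected set other than a singleton has no isolated point. This supplies second
  points of a cylinder arbitrarily close to a given one.\<close>

lemma nondegenerate_interval_islimpt:
  assumes "nondegenerate_interval S" "x \<in> S"
  shows "x islimpt S"
proof -
  have "connected S"
    using assms(1) nondegenerate_interval_convex convex_connected by blast
  moreover have "\<nexists>a. S = {a}"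
  proof
    assume "\<exists>a. S = {a}"
    then obtain c where c: "S = {c}" ..
    obtain a b where ab: "a < b" "{a<..<b} \<subseteq> S"
      using assms(1) unfolding nondegenerate_interval_def by fastforce
    then have "{a<..<b} \<subseteq> {c}"
      using c by simp
    then have "finite {a<..<b}"
      using finite_subset by blast
    then show False
      using ab(1) by (simp add: infinite_Ioo)
  qed
  ultimately show ?thesis
    using assms(2) connected_imp_perfect by blast
qed

section \<open>Cylinders, itineraries and iterates\<close>

lemma mem_cylinder_iff:
  assumes "ds \<noteq> []" "set ds \<subseteq> I"
  shows "x \<in> cylinder I \<Delta> F ds \<longleftrightarrow> x \<in> {0..<1} \<and> (\<forall>i<length ds. (F ^^ i) x \<in> \<Delta> (ds ! i))"
proof -
  have I: "ds ! i \<in> I" if "i < length ds" for i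
    using assms(2) that nth_mem by blast
  show ?thesis
  proof
    assume "x \<in> cylinder I \<Delta> F ds"
    then have "x \<in> iter_preimage (\<Union>d\<in>I. \<Delta> d) F i (\<Delta> (ds ! i))" if "i < length ds" for i
      using that by (simp add: cylinder_def)
    then show "x \<in> {0..<1} \<and> (\<forall>i<length ds. (F ^^ i) x \<in> \<Delta> (ds ! i))"
      \<comment> \<open>The factor \<open>i = 0\<close> exists because \<open>ds\<close> is nonempty
        and yields \<open>x \<in> {0..<1}\<close>; the cylinder of the empty word would be all of
        \<open>UNIV\<close>.\<close>
      using assms(1) unfolding iter_preimage_def iter_dom_def by blast
  next
    assume x: "x \<in> {0..<1} \<and> (\<forall>i<length ds. (F ^^ i) x \<in> \<Delta> (ds ! i))"
    then have "(F ^^ i) x \<in> (\<Union>d\<in>I. \<Delta> d)" if "i < length ds" for i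
      using I that by blast
    with x show "x \<in> cylinder I \<Delta> F ds"
      unfolding cylinder_def iter_preimage_def iter_dom_def by simp
  qed
qed

lemma cylinder_subset_iter_dom:
  assumes "ds \<noteq> []" "set ds \<subseteq> I"
  shows "cylinder I \<Delta> F ds \<subseteq> iter_dom (\<Union>d\<in>I. \<Delta> d) F (length ds)"
proof
  fix x
  assume "x \<in> cylinder I \<Delta> F ds"
  then have x: "x \<in> {0..<1}" "\<And>i. i < length ds \<Longrightarrow> (F ^^ i) x \<in> \<Delta> (ds ! i)"
    using mem_cylinder_iff[OF assms] by blast+
  have "(F ^^ i) x \<in> (\<Union>d\<in>I. \<Delta> d)" if "i < length ds" for i
    using x(2)[OF that] nth_mem[OF that] assms(2) by blast
  with x(1) show "x \<in> iter_dom (\<Union>d\<in>I. \<Delta> d) F (length ds)"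
    unfolding iter_dom_def by blast
qed

text \<open>\<open>F\<close> behaves well only piecewise, so the iterates of \<open>C\<close> are
  tracked through sets \<open>E k\<close> on which it does; these will be the partition intervals
  named by a word.\<close>

lemma funpow_continuous_inj_on:
  assumes "\<And>k. k < n \<Longrightarrow> (F ^^ k) ` C \<subseteq> E k"
    and "\<And>k. k < n \<Longrightarrow> continuous_on (E k) F \<and> inj_on F (E k)"
  shows "continuous_on C (F ^^ n) \<and> inj_on (F ^^ n) C"
  using assms
proof (induction n)
  case 0
  then show ?case by (simp add: continuous_on_id)
next
  case (Suc n)
  have IH: "continuous_on C (F ^^ n)" "inj_on (F ^^ n) C"
    using Suc by auto
  have "continuous_on ((F ^^ n) ` C) F" "inj_on F ((F ^^ n) ` C)"
    using Suc.prems(1)[of n] Suc.prems(2)[of n] continuous_on_subset inj_on_subset by blast+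
  with IH show ?case
    unfolding funpow.simps by (intro conjI continuous_on_compose comp_inj_on)
qed

lemma PIM_inj_on:
  assumes "PIM I \<Delta> F" "d \<in> I"
  shows "inj_on F (\<Delta> d)"
proof -
  have "strict_mono_on (\<Delta> d) F \<or> strict_antimono_on (\<Delta> d) F"
    using assms unfolding PIM_def by blast
  then show ?thesis
    unfolding monotone_on_def inj_on_def by (metis linorder_neqE order_less_irrefl)
qed

lemma funpow_cylinder:
  assumes "PIM I \<Delta> F" "ds \<noteq> []" "set ds \<subseteq> I"
  shows "continuous_on (cylinder I \<Delta> F ds) (F ^^ length ds)"
    and "inj_on (F ^^ length ds) (cylinder I \<Delta> F ds)"
proof -
  have I: "ds ! k \<in> I" if "k < length ds" for k
    using assms(3) that nth_mem by blast
  have "continuous_on (cylinder I \<Delta> F ds) (F ^^ length ds) \<and>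
        inj_on (F ^^ length ds) (cylinder I \<Delta> F ds)"
  proof (rule funpow_continuous_inj_on[where E = "\<lambda>k. \<Delta> (ds ! k)"])
    show "(F ^^ k) ` cylinder I \<Delta> F ds \<subseteq> \<Delta> (ds ! k)" if "k < length ds" for k
      using that by (auto simp: mem_cylinder_iff[OF assms(2,3)])
    show "continuous_on (\<Delta> (ds ! k)) F \<and> inj_on F (\<Delta> (ds ! k))" if "k < length ds" for k
      using I[OF that] PIM_inj_on[OF assms(1)] assms(1) unfolding PIM_def by blast
  qed
  then show "continuous_on (cylinder I \<Delta> F ds) (F ^^ length ds)"
    "inj_on (F ^^ length ds) (cylinder I \<Delta> F ds)" by auto
qed

lemma nonescaping_funpow:
  assumes "x \<in> nonescaping D F" "D \<subseteq> {0..<1}"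
  shows "(F ^^ m) x \<in> nonescaping D F"
proof -
  have "(F ^^ k) x \<in> D" for k
    using assms(1) by (auto simp: nonescaping_def)
  then have "(F ^^ k) ((F ^^ m) x) \<in> D" for k
    by (metis comp_apply funpow_add)
  moreover from this[of 0] have "(F ^^ m) x \<in> {0..<1}"
    using assms(2) by auto
  ultimately show ?thesis
    by (auto simp: nonescaping_def iter_dom_def)
qed

text \<open>The word is the initial part of the itinerary of \<open>x\<close> through the
  partition.\<close>

lemma nonescaping_cylinder:
  assumes "x \<in> nonescaping (\<Union>d\<in>I. \<Delta> d) F"
  obtains ds where "length ds = n" "set ds \<subseteq> I"
    "\<And>i. i < n \<Longrightarrow> (F ^^ i) x \<in> \<Delta> (ds ! i)"
proof -
  have "\<forall>i. \<exists>d\<in>I. (F ^^ i) x \<in> \<Delta> d"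
    using assms by (auto simp: nonescaping_def)
  then obtain d where "\<And>i. d i \<in> I \<and> (F ^^ i) x \<in> \<Delta> (d i)"
    by metis
  then show ?thesis
    by (intro that[of "map d [0..<n]"]) auto
qed

lemma PIM_domain_subset:
  assumes "PIM I \<Delta> F"
  shows "(\<Union>d\<in>I. \<Delta> d) \<subseteq> {0..<1}"
  using assms unfolding PIM_def interval_partition_def by blast

text \<open>The image point can be an endpoint of the image interval, for instance when
  \<open>y\<close> is an endpoint of its cylinder; hence the closure of the interior. Positivity of
  \<open>n\<close> makes the coding word nonempty.\<close>

lemma funpow_mem_closure_interior_image:
  assumes PIM: "PIM I \<Delta> F" and y: "y \<in> nonescaping (\<Union>d\<in>I. \<Delta> d) F"
    and U: "open U" "y \<in> U" and n: "n > 0"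
  shows "(F ^^ n) y \<in> closure (interior ((F ^^ n) ` (U \<inter> iter_dom (\<Union>d\<in>I. \<Delta> d) F n)))"
proof -
  obtain ds where ds: "length ds = n" "set ds \<subseteq> I" "\<And>i. i < n \<Longrightarrow> (F ^^ i) y \<in> \<Delta> (ds ! i)"
    using nonescaping_cylinder[OF y] by metis
  have ne: "ds \<noteq> []"
    using ds(1) n by auto
  define C where "C = cylinder I \<Delta> F ds"
  have "y \<in> {0..<1}"
    using y by (auto simp: nonescaping_def iter_dom_def)
  then have yC: "y \<in> C"
    using ds unfolding C_def mem_cylinder_iff[OF ne ds(2)] by auto
  then have C: "nondegenerate_interval C"
    using PIM ne ds(2) unfolding C_def PIM_def by blast
  obtain e where e: "e > 0" "ball y e \<subseteq> U"
    using U openE by blast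
  define J where "J = ball y e \<inter> C"
  have "convex J"
    unfolding J_def using nondegenerate_interval_convex[OF C] by (simp add: convex_Int)
  moreover have "continuous_on J (F ^^ n)"
    using funpow_cylinder(1)[OF PIM ne ds(2)] ds(1) continuous_on_subset
    unfolding J_def C_def by blast
  ultimately have conn: "connected ((F ^^ n) ` J)"
    by (simp add: connected_continuous_image convex_connected)
  obtain w where w: "w \<in> C" "w \<noteq> y" "w \<in> ball y e"
    using nondegenerate_interval_islimpt[OF C yC] e(1) unfolding islimpt_approachable
    by (metis dist_commute mem_ball)
  have yJ: "y \<in> J" and wJ: "w \<in> J"
    using yC w e(1) by (auto simp: J_def)
  \<comment> \<open>Injectivity on the cylinder keeps the connected image from collapsing to a
    point.\<close>
  have "(F ^^ n) y \<noteq> (F ^^ n) w"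
    using funpow_cylinder(2)[OF PIM ne ds(2)] ds(1) yC w unfolding C_def inj_on_def by metis
  then have "(F ^^ n) y \<in> closure (interior ((F ^^ n) ` J))"
    using connected_subset_closure_interior[OF conn] yJ wJ by blast
  moreover have "J \<subseteq> U \<inter> iter_dom (\<Union>d\<in>I. \<Delta> d) F n"
    using e(2) cylinder_subset_iter_dom[OF ne ds(2)] ds(1) unfolding J_def C_def by blast
  then have "closure (interior ((F ^^ n) ` J))
      \<subseteq> closure (interior ((F ^^ n) ` (U \<inter> iter_dom (\<Union>d\<in>I. \<Delta> d) F n)))"
    by (intro closure_mono interior_mono image_mono)
  ultimately show ?thesis
    by (rule rev_subsetD)
qed

section \<open>Dense orbits and the open sets G(U)\<close>

lemma dense_orbit_tail:
  assumes "{0..<1} \<subseteq> closure (forward_orbit F x)"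
  shows "{0..<1} \<subseteq> closure {(F ^^ n) x | n. n > (m::nat)}"
proof
  fix y :: real
  assume y: "y \<in> {0..<1}"
  have "{..m} \<union> {m<..} = UNIV"
    by auto
  then have "forward_orbit F x = (\<lambda>n. (F ^^ n) x) ` ({..m} \<union> {m<..})"
    by (simp add: forward_orbit_def full_SetCompr_eq)
  also have "\<dots> = (\<lambda>n. (F ^^ n) x) ` {..m} \<union> {(F ^^ n) x | n. n > m}"
    by (auto simp: image_Un)
  finally have split: "forward_orbit F x = (\<lambda>n. (F ^^ n) x) ` {..m} \<union> {(F ^^ n) x | n. n > m}" .
  \<comment> \<open>Limit points, unlike closure points, survive the removal of finitely many
    points. Since \<open>{0..<1}\<close> has no isolated point, \<open>y\<close> is a limit point of
    the orbit.\<close>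
  have "nondegenerate_interval {0..<1}"
    unfolding nondegenerate_interval_def using zero_less_one by blast
  then have "y islimpt {0..<1}"
    using y nondegenerate_interval_islimpt by blast
  then have "y islimpt forward_orbit F x"
    using islimpt_subset[OF _ assms] limpt_of_closure by metis
  then have "y islimpt {(F ^^ n) x | n. n > m}"
    unfolding split by (subst (asm) islimpt_Un_finite) simp_all
  then show "y \<in> closure {(F ^^ n) x | n. n > m}"
    by (simp add: closure_def)
qed

text \<open>Images of open sets under iterates need not be open, so interiors are taken to obtain an
  open set. Each of its points has a preimage in \<open>U\<close> under some iterate.\<close>

definition image_interiors :: "real set \<Rightarrow> (real \<Rightarrow> real) \<Rightarrow> real set \<Rightarrow> real set" where
  "image_interiors D F U = (\<Union>n. interior ((F ^^ n) ` (U \<inter> iter_dom D F n)))"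

lemma open_image_interiors: "open (image_interiors D F U)"
  unfolding image_interiors_def by blast

lemma funpow_iter_dom:
  assumes "F ` D \<subseteq> {0..<1}"
  shows "(F ^^ n) ` iter_dom D F n \<subseteq> {0..<1}"
proof (cases n)
  case 0
  then show ?thesis by (auto simp: iter_dom_def)
next
  case (Suc k)
  \<comment> \<open>The last index controlled by \<open>iter_dom\<close> is
    \<open>k = n - 1\<close>, so the \<open>n\<close>-th iterate is a value of \<open>F\<close> on
    \<open>D\<close>.\<close>
  then have "(F ^^ k) x \<in> D" if "x \<in> iter_dom D F n" for x
    using that unfolding iter_dom_def by blast
  with assms Suc show ?thesis
    by (simp add: image_subset_iff)
qed

text \<open>This makes the open set relatively open in \<open>{0..1}\<close>, where Baire's theorem
  is applied.\<close>

lemma image_interiors_subset: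
  assumes "F ` D \<subseteq> {0..<1}"
  shows "image_interiors D F U \<subseteq> {0..<1}"
proof -
  have "interior ((F ^^ n) ` (U \<inter> iter_dom D F n)) \<subseteq> {0..<1}" for n
    using interior_subset funpow_iter_dom[OF assms, of n] by blast
  then show ?thesis
    unfolding image_interiors_def by blast
qed

text \<open>Once the orbit enters \<open>U\<close> at time \<open>m\<close>, each later point is
  reached from \<open>U\<close> in \<open>n - m > 0\<close> steps and so lies in the closure; these
  later points are still dense.\<close>

lemma image_interiors_dense:
  assumes PIM: "PIM I \<Delta> F" and x: "x \<in> nonescaping (\<Union>d\<in>I. \<Delta> d) F"
    and dense: "{0..<1} \<subseteq> closure (forward_orbit F x)"
    and U: "open U" "U \<inter> {0..<1} \<noteq> {}"
  shows "{0..<1} \<subseteq> closure (image_interiors (\<Union>d\<in>I. \<Delta> d) F U)"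
proof -
  let ?D = "\<Union>d\<in>I. \<Delta> d"
  obtain m where m: "(F ^^ m) x \<in> U"
    using U dense open_Int_closure_eq_empty[OF U(1), of "forward_orbit F x"]
    unfolding forward_orbit_def by blast
  have y: "(F ^^ m) x \<in> nonescaping ?D F"
    using nonescaping_funpow[OF x PIM_domain_subset[OF PIM]] .
  have "(F ^^ n) x \<in> closure (image_interiors ?D F U)" if "n > m" for n
  proof -
    have "(F ^^ (n - m)) ((F ^^ m) x) = (F ^^ n) x"
      using that by (simp flip: funpow_add comp_apply[of "F ^^ (n - m)" "F ^^ m"])
    moreover have "interior ((F ^^ (n - m)) ` (U \<inter> iter_dom ?D F (n - m))) \<subseteq> image_interiors ?D F U"
      unfolding image_interiors_def by blast
    then have "closure (interior ((F ^^ (n - m)) ` (U \<inter> iter_dom ?D F (n - m))))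
        \<subseteq> closure (image_interiors ?D F U)"
      by (rule closure_mono)
    moreover have "(F ^^ (n - m)) ((F ^^ m) x)
        \<in> closure (interior ((F ^^ (n - m)) ` (U \<inter> iter_dom ?D F (n - m))))"
      using funpow_mem_closure_interior_image[OF PIM y U(1) m] that by simp
    ultimately show ?thesis
      by auto
  qed
  then have "closure {(F ^^ n) x | n. n > m} \<subseteq> closure (image_interiors ?D F U)"
    by (intro closure_minimal) auto
  then show ?thesis
    using dense_orbit_tail[OF dense, of m] by blast
qed

section \<open>Baire category and the backward orbit\<close>

theorem theorem26:
  fixes I :: "'d set" and \<Delta> :: "'d \<Rightarrow> real set" and F :: "real \<Rightarrow> real"
  assumes "PIM I \<Delta> F"
    and "TT I \<Delta> F"
  shows "PTT I \<Delta> F"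
proof -
  let ?D = "\<Union>d\<in>I. \<Delta> d"
  obtain x where x: "x \<in> nonescaping ?D F" "{0..<1} \<subseteq> closure (forward_orbit F x)"
    using assms(2) unfolding TT_def dense_in_unit_def by blast
  have FD: "F ` ?D \<subseteq> {0..<1}"
    using assms(1) unfolding PIM_def by blast
  obtain B :: "real set set" where B: "countable B" "topological_basis B"
    using ex_countable_basis by blast
  \<comment> \<open>Density of G(U) is available only for basis sets meeting
    \<open>{0..<1}\<close>.\<close>
  define B' where "B' = {U \<in> B. U \<inter> {0..<1} \<noteq> {}}"
  define \<G> where "\<G> = image_interiors ?D F ` B'"
  \<comment> \<open>Baire's theorem is used in the closed interval; adding the endpoint 1 does not
    affect density.\<close>
  have "{0..1} \<subseteq> closure (\<Inter>\<G>)"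
  proof (rule Baire)
    show "closed {0..1::real}" by simp
    show "countable \<G>"
      using B(1) unfolding \<G>_def B'_def by auto
    fix T
    assume "T \<in> \<G>"
    then obtain U where U: "U \<in> B" "U \<inter> {0..<1} \<noteq> {}" "T = image_interiors ?D F U"
      unfolding \<G>_def B'_def by blast
    have "T \<subseteq> {0..1}"
      using image_interiors_subset[OF FD, of U] U(3) by force
    moreover have "{0..<1} \<subseteq> closure T"
      using image_interiors_dense[OF assms(1) x] topological_basis_open[OF B(2)] U by blast
    then have "closure {0..<1} \<subseteq> closure T"
      by (rule closure_minimal) simp
    then have "{0..1} \<subseteq> closure T"
      by simp
    ultimately show "openin (top_of_set {0..1}) T \<and> {0..1} \<subseteq> closure T"
      using open_image_interiors[of ?D F U] U(3) by (simp add: open_subset)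
  qed
  \<comment> \<open>The point \<open>1/2\<close> shows that the open interval meets the closure of
    the intersection; being open, it meets the intersection itself, which places \<open>z\<close> in
    \<open>{0..<1}\<close>.\<close>
  moreover have "1/2 \<in> {0..1::real}" "1/2 \<in> {0<..<1::real}"
    by simp_all
  ultimately have "{0<..<1} \<inter> closure (\<Inter>\<G>) \<noteq> {}"
    by blast
  then have "{0<..<1} \<inter> \<Inter>\<G> \<noteq> {}"
    by (simp add: open_Int_closure_eq_empty)
  then obtain z where "z \<in> \<Inter>\<G>" "z \<in> {0<..<1}"
    by blast
  then have z: "z \<in> \<Inter>\<G>" "z \<in> {0..<1}"
    by simp_all
  have "{0..<1} \<subseteq> closure (backward_orbit ?D F z)"
  proof
    fix y :: real
    assume y: "y \<in> {0..<1}"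
    have "\<exists>w\<in>backward_orbit ?D F z. w \<in> V" if V: "open V" "y \<in> V" for V
    proof -
      obtain U where U: "U \<in> B" "y \<in> U" "U \<subseteq> V"
        using topological_basisE[OF B(2) V] by metis
      \<comment> \<open>The point \<open>y\<close> witnesses that \<open>U\<close> belongs to
        \<open>B'\<close>.\<close>
      then have "z \<in> image_interiors ?D F U"
        using z(1) y unfolding \<G>_def B'_def by blast
      \<comment> \<open>A preimage of \<open>z\<close> in \<open>U\<close> under this iterate is a
        backward orbit point in \<open>V\<close>.\<close>
      then obtain n where "z \<in> (F ^^ n) ` (U \<inter> iter_dom ?D F n)"
        unfolding image_interiors_def using interior_subset by blast
      then show ?thesis
        using U(3) unfolding backward_orbit_def by blast
    qed
    then show "y \<in> closure (backward_orbit ?D F z)"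
      unfolding closure_iff_nhds_not_empty by blast
  qed
  moreover have "backward_orbit ?D F z \<subseteq> {0..<1}"
    unfolding backward_orbit_def iter_dom_def by blast
  ultimately show ?thesis
    using z(2) unfolding PTT_def dense_in_unit_def by blast
qed

end
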